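(* Let $X$ be a compact complex manifold of dimension $k$ and let $f:X\to X$ be a dominating meromorphic map. For $0\le m\le k$ and $1\le l\le m$, we have $$h^{top}_{(m,l-1)}(f)\geq h^{top}_{(m,l)}(f).$$
   Context: $I$ is the indeterminacy set of $f$, $d$ is a fixed distance on $X$ (compatible with the manifold structure), and a finite family of charts of $X$ is fixed. Balls and graphs. In a chart one uses the norm $\|x\|=\max(|x_1|,\dots,|x_k|)$. $B_l(x,r)$ denotes a ball of dimension $l$ with center $x$ and radius $r$: in a chart it is the ball of an (affine) complex plane $P$ of dimension $l$. A graph of a holomorphic map $\Phi$ over $B_l(x,r)$ is a set $\{(X',\Phi(X')): X'\in B_l(x,r)\}$ in a chart, written in orthonormal linear coordinates adapted to $P$ (first $l$ coordinates along $P$, the other $k-l$ along the orthogonal complement, $\Phi$ taking values in the latter), norms being max norms in these coordinates; $Lip(\Phi)$ is the Lipschitz constant. For $0\le l\le k$, $\delta>0$, $n\in\mathbb{N}$: - $X_l^{\delta,n}$ is the set of $W\subset X$ such that $W$ is a graph of a holomorphic map $\Phi$ over a ball $B_l(x,e^{-\delta n})$ with $Lip(\Phi)\le 1$ and $f^j(W)\subset X\setminus I$ for all $0\le j\le n-1$. - $X_l^{\delta}$ is the set of $W\subset X$ such that $W$ is a graph of a holomorphic map $\Phi$ over a ball $B_l(x,\delta)$ with $Lip(\Phi)\le1$ and $\Phi(x)=0$. Conventions: $B_0(x,r)=\{x\}$, $X_0^{\delta,n}=\{x\in X: f^j(x)\in X\setminus I \text{ for all } 0\le j\le n-1\}$,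 $X_0^\delta=X$, and a graph over $B_k(x,r)$ is $B_k(x,r)$ itself. For $A,B\subset X$, $d(A,B)=\inf\{d(x,y):x\in A,\ y\in B\}$. A set $E\subset X_l^{\delta,n}$ is $(n,\delta)$-separated if $\max_{0\le i\le n-1} d(f^i(W),f^i(W'))\ge\delta$ for all $W\ne W'$ in $E$. For $0\le l\le m\le k$ the $(m,l)$-topological entropy is $$h^{top}_{(m,l)}(f)=\limsup_{\delta\to0}\ \limsup_{n\to\infty}\frac1n\log\sup_{\Delta\in X_m^\delta}\max\{\#E:\ E\subset X_l^{\delta,n}\ (n,\delta)\text{-separated},\ W\subset f^{-n}(\Delta)\ \text{for all } W\in E\}.$$ For $W\in X_l^{\delta,n}$, $W\subset f^{-n}(\Delta)$ means $f^n(W)\subset\Delta$. *)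

theory Defs
  imports "HOL-Analysis.Analysis"
begin

subsection \<open>Holomorphic functions of several variables\<close>

text \<open>
  Complex Frechet differentiability at every point of \<open>D\<close>. The set \<open>D\<close> is either open, or
  relatively open in a coordinate subspace; in the latter case the derivative within \<open>D\<close> only
  sees the directions of that subspace, and this is holomorphy in the coordinates that span it.
\<close>

definition holo_on :: "(complex^'n \<Rightarrow> complex) \<Rightarrow> (complex^'n) set \<Rightarrow> bool" where
  "holo_on h D \<longleftrightarrow>
     (\<forall>z\<in>D. \<exists>L. (h has_derivative L) (at z within D) \<and> (\<forall>c v. L (c *s v) = c * L v))"

definition vec_holo_on :: "(complex^'n \<Rightarrow> complex^'m) \<Rightarrow> (complex^'n) set \<Rightarrow> bool" where
  "vec_holo_on F D \<longleftrightarrow> (\<forall>j. holo_on (\<lambda>z. F z $ j) D)"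


subsection \<open>Complex manifolds\<close>

text \<open>
  A manifold is a whole type, with an atlas of charts \<open>(U, \<phi>)\<close>. Its dimension is \<open>CARD('n)\<close>.
\<close>

type_synonym ('a, 'n) chart = "'a set \<times> ('a \<Rightarrow> complex^'n)"

definition complex_atlas :: "('a::topological_space, 'n::finite) chart set \<Rightarrow> bool" where
  "complex_atlas A \<longleftrightarrow>
     (\<forall>(U, \<phi>)\<in>A. open U \<and> open (\<phi> ` U) \<and> (\<exists>\<psi>. homeomorphism U (\<phi> ` U) \<phi> \<psi>)) \<and>
     (\<Union>(U, \<phi>)\<in>A. U) = UNIV \<and>
     (\<forall>(U, \<phi>)\<in>A. \<forall>(V, \<psi>)\<in>A. vec_holo_on (\<lambda>z. \<psi> (inv_into U \<phi> z)) (\<phi> ` (U \<inter> V)))"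

definition compact_complex_manifold :: "('a::t2_space, 'n::finite) chart set \<Rightarrow> bool" where
  "compact_complex_manifold A \<longleftrightarrow> complex_atlas A \<and> compact (UNIV :: 'a set)"

text \<open>The charts of the complex structure that \<open>A\<close> defines, i.e. of the maximal atlas.\<close>

definition is_chart :: "('a::topological_space, 'n::finite) chart set \<Rightarrow> ('a, 'n) chart \<Rightarrow> bool" where
  "is_chart A c \<longleftrightarrow> complex_atlas (insert c A)"

definition product_atlas ::
  "('a, 'n::finite) chart set \<Rightarrow> ('b, 'm::finite) chart set \<Rightarrow> ('a \<times> 'b, 'n + 'm) chart set" where
  "product_atlas A B =
     {(U \<times> V, \<lambda>(p, q). \<chi> s. case s of Inl i \<Rightarrow> \<phi> p $ i | Inr j \<Rightarrow> \<psi> q $ j) | U \<phi> V \<psi>.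
        (U, \<phi>) \<in> A \<and> (V, \<psi>) \<in> B}"

definition mfd_holo_fun ::
  "('a::topological_space, 'n::finite) chart set \<Rightarrow> 'a set \<Rightarrow> ('a \<Rightarrow> complex) \<Rightarrow> bool" where
  "mfd_holo_fun A N h \<longleftrightarrow> (\<forall>(U, \<phi>)\<in>A. holo_on (\<lambda>z. h (inv_into U \<phi> z)) (\<phi> ` (U \<inter> N)))"

definition mfd_holo_map ::
  "('a::topological_space, 'n::finite) chart set \<Rightarrow> ('b::topological_space, 'm::finite) chart set \<Rightarrow>
   'a set \<Rightarrow> ('a \<Rightarrow> 'b) \<Rightarrow> bool" where
  "mfd_holo_map A B N g \<longleftrightarrow> continuous_on N g \<and>
     (\<forall>(V, \<psi>)\<in>B. \<forall>j. mfd_holo_fun A (N \<inter> g -` V) (\<lambda>p. \<psi> (g p) $ j))"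

definition analytic_subset ::
  "('a::topological_space, 'n::finite) chart set \<Rightarrow> 'a set \<Rightarrow> bool" where
  "analytic_subset A Z \<longleftrightarrow>
     (\<forall>p. \<exists>N H. open N \<and> p \<in> N \<and> finite H \<and> (\<forall>h\<in>H. mfd_holo_fun A N h) \<and>
        Z \<inter> N = {q \<in> N. \<forall>h\<in>H. h q = 0})"


subsection \<open>Meromorphic maps\<close>

text \<open>
  A meromorphic map \<open>X \<rightarrow> X\<close> (in the sense of Remmert) is given by its graph \<open>\<Gamma>\<close>: an analytic
  subset of \<open>X \<times> X\<close> whose first projection is a proper modification. That is, off a nowhere dense
  analytic set \<open>Z\<close> it is the graph of a holomorphic map, and the part of \<open>\<Gamma>\<close> lying over \<open>Z\<close> is
  nowhere dense in \<open>\<Gamma>\<close>. Properness of the projection is automatic for compact \<open>X\<close>.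
\<close>

definition meromorphic_map ::
  "('a::topological_space, 'n::finite) chart set \<Rightarrow> ('a \<times> 'a) set \<Rightarrow> bool" where
  "meromorphic_map A \<Gamma> \<longleftrightarrow>
     analytic_subset (product_atlas A A) \<Gamma> \<and>
     (\<exists>Z g. analytic_subset A Z \<and> interior Z = {} \<and>
        mfd_holo_map A A (- Z) g \<and>
        \<Gamma> \<inter> (- Z) \<times> UNIV = (\<lambda>p. (p, g p)) ` (- Z) \<and>
        \<Gamma> \<subseteq> closure (\<Gamma> \<inter> (- Z) \<times> UNIV))"

definition dominating_meromorphic_map ::
  "('a::topological_space, 'n::finite) chart set \<Rightarrow> ('a \<times> 'a) set \<Rightarrow> bool" where
  "dominating_meromorphic_map A \<Gamma> \<longleftrightarrow> meromorphic_map A \<Gamma> \<and> snd ` \<Gamma> = UNIV"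

text \<open>The complement of the largest open set on which the map is holomorphic.\<close>

definition indeterminacy ::
  "('a::topological_space, 'n::finite) chart set \<Rightarrow> ('a \<times> 'a) set \<Rightarrow> 'a set" where
  "indeterminacy A \<Gamma> =
     {p. \<not> (\<exists>N g. open N \<and> p \<in> N \<and> mfd_holo_map A A N g \<and> \<Gamma> \<inter> N \<times> UNIV = (\<lambda>q. (q, g q)) ` N)}"

text \<open>Only meaningful off the indeterminacy set, the only place where it is used.\<close>

definition mero_fun :: "('a \<times> 'a) set \<Rightarrow> 'a \<Rightarrow> 'a" where
  "mero_fun \<Gamma> p = (THE q. (p, q) \<in> \<Gamma>)"

abbreviation mero_iter :: "('a \<times> 'a) set \<Rightarrow> nat \<Rightarrow> 'a \<Rightarrow> 'a" where
  "mero_iter \<Gamma> n \<equiv> mero_fun \<Gamma> ^^ n"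


subsection \<open>Graphs over balls of complex planes\<close>

definition max_norm :: "complex^'n::finite \<Rightarrow> real" where
  "max_norm v = (MAX i. cmod (v $ i))"

definition orthonormal_frame :: "('n::finite \<Rightarrow> complex^'n) \<Rightarrow> bool" where
  "orthonormal_frame e \<longleftrightarrow>
     (\<forall>i j. (\<Sum>s\<in>UNIV. e i $ s * cnj (e j $ s)) = (if i = j then 1 else 0))"

text \<open>
  Orthonormal coordinates adapted to an affine plane \<open>P\<close> through \<open>x\<close> are given by an orthonormal
  frame \<open>e\<close> and the set \<open>S\<close> of those indices \<open>i\<close> for which \<open>e i\<close> is tangent to \<open>P\<close>, so that the
  dimension of \<open>P\<close> is \<open>card S\<close>; coordinates are centred at \<open>x\<close>. In these coordinates
  \<open>coord_ball S r\<close> is the ball of \<open>P\<close> with centre \<open>x\<close> and radius \<open>r\<close>.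
\<close>

definition coord_ball :: "'n::finite set \<Rightarrow> real \<Rightarrow> (complex^'n) set" where
  "coord_ball S r = {z. (\<forall>i. i \<notin> S \<longrightarrow> z $ i = 0) \<and> max_norm z < r}"

text \<open>
  \<open>W\<close> is, in the chart \<open>(U, \<phi>)\<close>, the graph of the holomorphic map \<open>\<Phi>\<close> over the ball with centre \<open>x\<close>
  and radius \<open>r\<close>, and \<open>\<Phi>\<close> is 1-Lipschitz. When \<open>S = UNIV\<close> the map \<open>\<Phi>\<close> vanishes and \<open>W\<close> is the ball
  itself; it is then required to be the ball for the max norm of the chart.
\<close>

definition is_graph ::
  "('a, 'n::finite) chart \<Rightarrow> 'n set \<Rightarrow> ('n \<Rightarrow> complex^'n) \<Rightarrow> complex^'n \<Rightarrow> real \<Rightarrow>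
   (complex^'n \<Rightarrow> complex^'n) \<Rightarrow> 'a set \<Rightarrow> bool" where
  "is_graph c S e x r \<Phi> W \<longleftrightarrow>
     orthonormal_frame e \<and> (S = UNIV \<longrightarrow> e = (\<lambda>i. axis i 1)) \<and>
     (\<forall>z\<in>coord_ball S r. \<forall>i\<in>S. \<Phi> z $ i = 0) \<and>
     vec_holo_on \<Phi> (coord_ball S r) \<and>
     (\<forall>z\<in>coord_ball S r. \<forall>w\<in>coord_ball S r. max_norm (\<Phi> z - \<Phi> w) \<le> max_norm (z - w)) \<and>
     W \<subseteq> fst c \<and>
     snd c ` W = (\<lambda>z. x + (\<Sum>i\<in>UNIV. (z + \<Phi> z) $ i *s e i)) ` coord_ball S r"


subsection \<open>Intermediate entropies\<close>

text \<open>
  \<open>C\<close> is the fixed family of charts. \<open>discs_orbit A C \<Gamma> l \<delta> n\<close> is $X_l^{\delta,n}$ and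
  \<open>discs C m \<delta>\<close> is $X_m^{\delta}$.
\<close>

definition discs_orbit ::
  "('a::topological_space, 'n::finite) chart set \<Rightarrow> ('a, 'n) chart set \<Rightarrow> ('a \<times> 'a) set \<Rightarrow>
   nat \<Rightarrow> real \<Rightarrow> nat \<Rightarrow> 'a set set" where
  "discs_orbit A C \<Gamma> l \<delta> n =
     {W. (if l = 0 then \<exists>p. W = {p}
          else \<exists>c\<in>C. \<exists>S e x \<Phi>. card S = l \<and> is_graph c S e x (exp (- \<delta> * real n)) \<Phi> W) \<and>
         (\<forall>j<n. mero_iter \<Gamma> j ` W \<subseteq> - indeterminacy A \<Gamma>)}"

definition discs :: "('a, 'n::finite) chart set \<Rightarrow> nat \<Rightarrow> real \<Rightarrow> 'a set set" where
  "discs C m \<delta> =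
     {W. if m = 0 then \<exists>p. W = {p}
         else \<exists>c\<in>C. \<exists>S e x \<Phi>. card S = m \<and> is_graph c S e x \<delta> \<Phi> W \<and> \<Phi> 0 = 0}"

definition separated ::
  "('a::metric_space \<times> 'a) set \<Rightarrow> nat \<Rightarrow> real \<Rightarrow> 'a set set \<Rightarrow> bool" where
  "separated \<Gamma> n \<delta> E \<longleftrightarrow>
     (\<forall>W\<in>E. \<forall>W'\<in>E. W \<noteq> W' \<longrightarrow>
        (MAX i\<in>{..<n}. setdist (mero_iter \<Gamma> i ` W) (mero_iter \<Gamma> i ` W')) \<ge> \<delta>)"

definition ext_card :: "'b set \<Rightarrow> ereal" where
  "ext_card E = (if finite E then ereal (real (card E)) else \<infinity>)"

text \<open>Extended logarithm, with \<open>log 0 = -\<infinity>\<close>.\<close>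

definition ereal_log :: "ereal \<Rightarrow> ereal" where
  "ereal_log t = (if t \<le> 0 then -\<infinity> else if t = \<infinity> then \<infinity> else ereal (ln (real_of_ereal t)))"

definition max_separated ::
  "('a::metric_space, 'n::finite) chart set \<Rightarrow> ('a, 'n) chart set \<Rightarrow> ('a \<times> 'a) set \<Rightarrow>
   nat \<Rightarrow> real \<Rightarrow> nat \<Rightarrow> 'a set \<Rightarrow> ereal" where
  "max_separated A C \<Gamma> l \<delta> n \<Delta> =
     (SUP E\<in>{E. E \<subseteq> discs_orbit A C \<Gamma> l \<delta> n \<and> separated \<Gamma> n \<delta> E \<and>
                (\<forall>W\<in>E. mero_iter \<Gamma> n ` W \<subseteq> \<Delta>)}. ext_card E)"

definition top_entropy ::
  "('a::metric_space, 'n::finite) chart set \<Rightarrow> ('a, 'n) chart set \<Rightarrow> ('a \<times> 'a) set \<Rightarrow>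
   nat \<Rightarrow> nat \<Rightarrow> ereal" where
  "top_entropy A C \<Gamma> m l =
     Limsup (at_right 0) (\<lambda>\<delta>. limsup (\<lambda>n.
       ereal (1 / real n) * ereal_log (SUP \<Delta>\<in>discs C m \<delta>. max_separated A C \<Gamma> l \<delta> n \<Delta>)))"

end

theory Submission
  imports Defs
begin

text \<open>
  A graph over an \<open>l\<close>-dimensional ball contains a graph over an \<open>(l - 1)\<close>-dimensional ball of the
  same radius: restrict the map to a coordinate hyperplane through the centre. Replacing every
  member of a separated family of \<open>l\<close>-discs by such a subset keeps the orbits off the
  indeterminacy set, keeps the \<open>n\<close>-th images inside \<open>\<Delta>\<close>, and can only increase the distances
  between images, so the new family is again separated. It has as many members, because two members
  of a separated family are disjoint: a common point would make the distance of the images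
  vanish at every time. This compares the suprema of cardinalities for each \<open>\<delta> > 0\<close>, \<open>n \<ge> 1\<close> and
  \<open>\<Delta>\<close>, and everything applied to them in the entropy is monotone.

  The lemma \<open>is_graph_subgraph\<close> supplies the smaller graphs (for \<open>l = 1\<close> any point of the disc
  serves), \<open>separated_refine\<close> and \<open>separated_disjoint\<close> keep separation and cardinality.
\<close>

lemma holo_on_subset:
  assumes "holo_on h D" "D' \<subseteq> D"
  shows "holo_on h D'"
  unfolding holo_on_def
proof
  fix z assume "z \<in> D'"
  then obtain L where "(h has_derivative L) (at z within D)" "\<forall>c v. L (c *s v) = c * L v"
    using assms unfolding holo_on_def by blast
  then show "\<exists>L. (h has_derivative L) (at z within D') \<and> (\<forall>c v. L (c *s v) = c * L v)"
    using has_derivative_subset[OF _ assms(2)] by blast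
qed

lemma vec_holo_on_subset:
  assumes "vec_holo_on F D" "D' \<subseteq> D"
  shows "vec_holo_on F D'"
  using assms holo_on_subset unfolding vec_holo_on_def by blast

lemma coord_ball_mono:
  assumes "S' \<subseteq> S"
  shows "coord_ball S' r \<subseteq> coord_ball S r"
  using assms unfolding coord_ball_def by blast

lemma zero_in_coord_ball:
  assumes "0 < r"
  shows "0 \<in> coord_ball S r"
  using assms unfolding coord_ball_def max_norm_def by simp

lemma is_graph_nonempty:
  assumes "is_graph c S e x r \<Phi> W" "0 < r"
  shows "W \<noteq> {}"
proof -
  have "snd c ` W = (\<lambda>z. x + (\<Sum>i\<in>UNIV. (z + \<Phi> z) $ i *s e i)) ` coord_ball S r"
    using assms(1) unfolding is_graph_def by (elim conjE)
  moreover have "coord_ball S r \<noteq> {}"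
    using zero_in_coord_ball[OF assms(2)] by blast
  ultimately have "snd c ` W \<noteq> {}"
    by (simp only: image_is_empty not_False_eq_True)
  then show ?thesis
    by (simp only: image_is_empty not_False_eq_True)
qed

text \<open>
  The same \<open>\<Phi>\<close>, in the same frame, defines the smaller graph: a coordinate dropped from \<open>S\<close> turns
  from a coordinate of the base into one of the values, where \<open>\<Phi>\<close> has the value \<open>0\<close>. Properness of
  \<open>S'\<close> excludes \<open>S' = UNIV\<close>, the case in which the frame is prescribed.
\<close>

lemma is_graph_subgraph:
  assumes W: "is_graph c S e x r \<Phi> W" and S': "S' \<subset> S"
  obtains W' where "W' \<subseteq> W" "is_graph c S' e x r \<Phi> W'"
proof -
  define F where "F = (\<lambda>z. x + (\<Sum>i\<in>UNIV. (z + \<Phi> z) $ i *s e i))"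
  define W' where "W' = {p \<in> W. snd c p \<in> F ` coord_ball S' r}"
  have sub: "coord_ball S' r \<subseteq> coord_ball S r"
    using S' by (intro coord_ball_mono) blast
  note parts = W[unfolded is_graph_def, folded F_def]
  have frame: "orthonormal_frame e"
    using parts by (elim conjE)
  have zero: "\<forall>z\<in>coord_ball S r. \<forall>i\<in>S. \<Phi> z $ i = 0"
    using parts by (elim conjE)
  have holo: "vec_holo_on \<Phi> (coord_ball S r)"
    using parts by (elim conjE)
  have lip: "\<forall>z\<in>coord_ball S r. \<forall>w\<in>coord_ball S r. max_norm (\<Phi> z - \<Phi> w) \<le> max_norm (z - w)"
    using parts by (elim conjE)
  have dom: "W \<subseteq> fst c"
    using parts by (elim conjE)
  have img: "snd c ` W = F ` coord_ball S r"
    using parts by (elim conjE)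
  have "W' \<subseteq> W"
    unfolding W'_def by blast
  have "snd c ` W' = snd c ` W \<inter> F ` coord_ball S' r"
    unfolding W'_def by blast
  also have "\<dots> = F ` coord_ball S' r"
    unfolding img using sub by blast
  finally have img': "snd c ` W' = F ` coord_ball S' r" .
  have "is_graph c S' e x r \<Phi> W'"
    unfolding is_graph_def F_def[symmetric]
  proof (intro conjI)
    show "S' = UNIV \<longrightarrow> e = (\<lambda>i. axis i 1)"
      using S' by blast
    show "\<forall>z\<in>coord_ball S' r. \<forall>i\<in>S'. \<Phi> z $ i = 0"
      using zero sub S' by blast
    show "vec_holo_on \<Phi> (coord_ball S' r)"
      using holo sub by (rule vec_holo_on_subset)
    show "\<forall>z\<in>coord_ball S' r. \<forall>w\<in>coord_ball S' r. max_norm (\<Phi> z - \<Phi> w) \<le> max_norm (z - w)"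
      using lip sub by blast
    show "W' \<subseteq> fst c"
      using \<open>W' \<subseteq> W\<close> dom by (rule order_trans)
  qed (fact frame img')+
  with \<open>W' \<subseteq> W\<close> show thesis
    by (rule that)
qed

lemma discs_orbit_nonempty:
  assumes "W \<in> discs_orbit A C \<Gamma> l \<delta> n"
  shows "W \<noteq> {}"
proof (cases "l = 0")
  case True
  then show ?thesis
    using assms unfolding discs_orbit_def by auto
next
  case False
  then have "\<exists>c\<in>C. \<exists>S e x \<Phi>. card S = l \<and> is_graph c S e x (exp (- \<delta> * real n)) \<Phi> W"
    using assms unfolding discs_orbit_def by simp
  then show ?thesis
    by (elim bexE exE conjE) (rule is_graph_nonempty[OF _ exp_gt_zero])
qed

lemma discs_orbit_subdisc:
  assumes W: "W \<in> discs_orbit A C \<Gamma> (Suc l) \<delta> n"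
  shows "\<exists>W'\<subseteq>W. W' \<in> discs_orbit A C \<Gamma> l \<delta> n"
proof -
  have orb: "\<forall>j<n. mero_iter \<Gamma> j ` W \<subseteq> - indeterminacy A \<Gamma>"
    using W unfolding discs_orbit_def by blast
  have orb': "\<forall>j<n. mero_iter \<Gamma> j ` W' \<subseteq> - indeterminacy A \<Gamma>" if "W' \<subseteq> W" for W'
    using orb that by blast
  show ?thesis
  proof (cases "l = 0")
    case True
    obtain p where "p \<in> W"
      using discs_orbit_nonempty[OF W] by blast
    then have "{p} \<subseteq> W"
      by blast
    moreover have "{p} \<in> discs_orbit A C \<Gamma> l \<delta> n"
      using True orb'[OF \<open>{p} \<subseteq> W\<close>] unfolding discs_orbit_def by simp
    ultimately show ?thesis
      by blast
  next
    case False
    obtain c S e x \<Phi> where c: "c \<in> C" and S: "card S = Suc l"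
      and gr: "is_graph c S e x (exp (- \<delta> * real n)) \<Phi> W"
      using W unfolding discs_orbit_def by auto
    obtain i where i: "i \<in> S"
      using S by fastforce
    then have ps: "S - {i} \<subset> S" and S': "card (S - {i}) = l"
      using S by (auto simp: card_Diff_singleton)
    obtain W' where "W' \<subseteq> W" and gr': "is_graph c (S - {i}) e x (exp (- \<delta> * real n)) \<Phi> W'"
      by (rule is_graph_subgraph[OF gr ps])
    have "\<exists>c\<in>C. \<exists>S e x \<Phi>. card S = l \<and> is_graph c S e x (exp (- \<delta> * real n)) \<Phi> W'"
      using c S' gr' by blast
    then have "W' \<in> discs_orbit A C \<Gamma> l \<delta> n"
      using False orb'[OF \<open>W' \<subseteq> W\<close>] unfolding discs_orbit_def by simp
    then show ?thesis
      using \<open>W' \<subseteq> W\<close> by blast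
  qed
qed

text \<open>
  For \<open>n = 0\<close> the maximum in \<open>separated\<close> is over the empty set and carries no information, so
  disjointness can only be expected for \<open>n > 0\<close>.
\<close>

lemma separated_disjoint:
  assumes "separated \<Gamma> n \<delta> E" "0 < \<delta>" "0 < n" "W \<in> E" "W' \<in> E" "W \<noteq> W'"
  shows "W \<inter> W' = {}"
proof (rule ccontr)
  assume "W \<inter> W' \<noteq> {}"
  then obtain p where "p \<in> W" "p \<in> W'"
    by blast
  then have "setdist (mero_iter \<Gamma> i ` W) (mero_iter \<Gamma> i ` W') = 0" for i
    by (rule setdist_eq_0I[OF imageI imageI])
  then have "(MAX i\<in>{..<n}. setdist (mero_iter \<Gamma> i ` W) (mero_iter \<Gamma> i ` W')) = 0"
    using \<open>0 < n\<close> by (simp add: image_constant_conv lessThan_empty_iff)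
  moreover have "\<delta> \<le> (MAX i\<in>{..<n}. setdist (mero_iter \<Gamma> i ` W) (mero_iter \<Gamma> i ` W'))"
    using assms unfolding separated_def by blast
  ultimately show False
    using \<open>0 < \<delta>\<close> by linarith
qed

text \<open>
  Nonemptiness matters because the distance to the empty set is \<open>0\<close> by convention, so
  shrinking a set to nothing would destroy separation.
\<close>

lemma separated_refine:
  assumes sep: "separated \<Gamma> n \<delta> E" and n: "0 < n"
    and g: "\<And>W. W \<in> E \<Longrightarrow> g W \<subseteq> W \<and> g W \<noteq> {}"
  shows "separated \<Gamma> n \<delta> (g ` E)"
  unfolding separated_def
proof (intro ballI impI)
  fix V V' assume "V \<in> g ` E" "V' \<in> g ` E" "V \<noteq> V'"
  then obtain W W' where W: "W \<in> E" "W' \<in> E" "W \<noteq> W'" "V = g W" "V' = g W'"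
    by blast
  have mono: "setdist (mero_iter \<Gamma> i ` W) (mero_iter \<Gamma> i ` W')
      \<le> setdist (mero_iter \<Gamma> i ` V) (mero_iter \<Gamma> i ` V')" for i
  proof -
    have "setdist (mero_iter \<Gamma> i ` W) (mero_iter \<Gamma> i ` W')
        \<le> setdist (mero_iter \<Gamma> i ` V) (mero_iter \<Gamma> i ` W')"
      using W g[of W] by (intro setdist_subset_left image_mono) auto
    also have "\<dots> \<le> setdist (mero_iter \<Gamma> i ` V) (mero_iter \<Gamma> i ` V')"
      using W g[of W'] by (intro setdist_subset_right image_mono) auto
    finally show ?thesis .
  qed
  have "\<delta> \<le> (MAX i\<in>{..<n}. setdist (mero_iter \<Gamma> i ` W) (mero_iter \<Gamma> i ` W'))"
    using sep W unfolding separated_def by blast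
  then obtain i where "i < n" "\<delta> \<le> setdist (mero_iter \<Gamma> i ` W) (mero_iter \<Gamma> i ` W')"
    using n by (subst (asm) Max_ge_iff) auto
  then show "\<delta> \<le> (MAX i\<in>{..<n}. setdist (mero_iter \<Gamma> i ` V) (mero_iter \<Gamma> i ` V'))"
    using n order_trans[OF _ mono] by (subst Max_ge_iff) auto
qed

lemma max_separated_Suc_le:
  fixes A C :: "('a::metric_space, 'k::finite) chart set"
  assumes "0 < \<delta>" "0 < n"
  shows "max_separated A C \<Gamma> (Suc l) \<delta> n \<Delta> \<le> max_separated A C \<Gamma> l \<delta> n \<Delta>"
  unfolding max_separated_def
proof (rule SUP_mono)
  fix E assume "E \<in> {E. E \<subseteq> discs_orbit A C \<Gamma> (Suc l) \<delta> n \<and> separated \<Gamma> n \<delta> E \<and>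
      (\<forall>W\<in>E. mero_iter \<Gamma> n ` W \<subseteq> \<Delta>)}"
  then have E: "E \<subseteq> discs_orbit A C \<Gamma> (Suc l) \<delta> n" and sep: "separated \<Gamma> n \<delta> E"
    and \<Delta>: "\<And>W. W \<in> E \<Longrightarrow> mero_iter \<Gamma> n ` W \<subseteq> \<Delta>"
    by auto
  have "\<forall>W\<in>E. \<exists>V. V \<subseteq> W \<and> V \<in> discs_orbit A C \<Gamma> l \<delta> n"
  proof
    fix W assume "W \<in> E"
    then have "W \<in> discs_orbit A C \<Gamma> (Suc l) \<delta> n"
      using E by (rule rev_subsetD)
    then show "\<exists>V. V \<subseteq> W \<and> V \<in> discs_orbit A C \<Gamma> l \<delta> n"
      by (rule discs_orbit_subdisc)
  qed
  from bchoice[OF this]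
  obtain g where g: "\<And>W. W \<in> E \<Longrightarrow> g W \<subseteq> W \<and> g W \<in> discs_orbit A C \<Gamma> l \<delta> n"
    by blast
  have ne: "g W \<noteq> {}" if "W \<in> E" for W
    using g[OF that] discs_orbit_nonempty by blast
  have "inj_on g E"
  proof (rule inj_onI, rule ccontr)
    fix W W' assume "W \<in> E" "W' \<in> E" "g W = g W'" "W \<noteq> W'"
    then show False
      using separated_disjoint[OF sep assms \<open>W \<in> E\<close> \<open>W' \<in> E\<close>] g[of W] g[of W'] ne[of W] by auto
  qed
  then have "ext_card (g ` E) = ext_card E"
    unfolding ext_card_def by (simp add: card_image finite_image_iff)
  moreover have "g ` E \<subseteq> discs_orbit A C \<Gamma> l \<delta> n"
    using g by blast
  moreover have "separated \<Gamma> n \<delta> (g ` E)"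
    using g ne by (intro separated_refine[OF sep \<open>0 < n\<close>]) blast
  moreover have "\<forall>V\<in>g ` E. mero_iter \<Gamma> n ` V \<subseteq> \<Delta>"
    using g \<Delta> by blast
  ultimately show "\<exists>E'\<in>{E. E \<subseteq> discs_orbit A C \<Gamma> l \<delta> n \<and> separated \<Gamma> n \<delta> E \<and>
      (\<forall>W\<in>E. mero_iter \<Gamma> n ` W \<subseteq> \<Delta>)}. ext_card E \<le> ext_card E'"
    by (intro bexI[of _ "g ` E"] CollectI conjI) simp_all
qed

lemma ereal_log_mono:
  assumes "s \<le> t"
  shows "ereal_log s \<le> ereal_log t"
proof (cases "s \<le> 0 \<or> t = \<infinity>")
  case True
  then show ?thesis
    using assms by (auto simp: ereal_log_def)
next
  case False
  then obtain a b where "s = ereal a" "t = ereal b" "0 < a" "a \<le> b"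
    using assms by (cases s; cases t) auto
  then show ?thesis
    by (simp add: ereal_log_def)
qed

theorem proposition0p2:
  fixes A C :: "('a::metric_space, 'k::finite) chart set"
    and \<Gamma> :: "('a \<times> 'a) set"
    and m l :: nat
  assumes "compact_complex_manifold A"
    and "finite C" and "\<forall>c\<in>C. is_chart A c"
    and "dominating_meromorphic_map A \<Gamma>"
    and "m \<le> CARD('k)" and "1 \<le> l" and "l \<le> m"
  shows "top_entropy A C \<Gamma> m (l - 1) \<ge> top_entropy A C \<Gamma> m l"
proof -
  obtain l' where l: "l = Suc l'"
    using \<open>1 \<le> l\<close> by (cases l) auto
  let ?a = "\<lambda>j \<delta> n. ereal (1 / real n) *
    ereal_log (SUP \<Delta>\<in>discs C m \<delta>. max_separated A C \<Gamma> j \<delta> n \<Delta>)"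
  have "?a (Suc l') \<delta> n \<le> ?a l' \<delta> n" if "0 < \<delta>" "0 < n" for \<delta> n
    using that
    by (intro ereal_mult_left_mono ereal_log_mono SUP_mono' max_separated_Suc_le) auto
  then have "limsup (?a (Suc l') \<delta>) \<le> limsup (?a l' \<delta>)" if "0 < \<delta>" for \<delta>
    using that by (intro Limsup_mono eventually_mono[OF eventually_gt_at_top[of 0]]) auto
  then have "top_entropy A C \<Gamma> m (Suc l') \<le> top_entropy A C \<Gamma> m l'"
    unfolding top_entropy_def
    by (rule Limsup_mono[OF eventually_mono[OF eventually_at_right_less[of 0]]])
  then show ?thesis
    using l by simp
qed

end
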